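(* Let $\Omega_\infty=\mathbb{R}\times(0,1)$. There exist a $C^\infty$ function $f:\mathbb{R}\to\mathbb{R}$ and a positive solution $u$ of $$-\Delta u=f(u)\ \text{ in }\Omega_\infty,\qquad u(x_1,0)=0,\quad u(x_1,1)=0\ \text{ for all }x_1\in\mathbb{R},$$ such that $u$ is monotone along the $x_1$ direction and $u$ has at least one non-convex superlevel set $\{x\in\Omega_\infty:\ u(x)>\alpha\}$ for some $\alpha>0$.
   Context: Points of $\Omega_\infty$ are written $x=(x_1,x_2)$. "Positive" means $u>0$ in $\Omega_\infty$. "Monotone along the $x_1$ direction" means that the functions $x_1\mapsto u(x_1,x_2)$, $x_2\in(0,1)$, are all monotone in the same sense. *)

theory Defs
  imports "HOL-Analysis.Analysis"
begin

definition smooth :: "(real \<Rightarrow> real) \<Rightarrow> bool" where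
  "smooth f \<longleftrightarrow> (\<forall>n x. (deriv ^^ n) f differentiable at x)"

definition partial :: "'a::euclidean_space \<Rightarrow> ('a \<Rightarrow> real) \<Rightarrow> 'a \<Rightarrow> real" where
  "partial b u x = deriv (\<lambda>t. u (x + t *\<^sub>R b)) 0"

(* deriv is total, so existence of the partial derivatives must be required separately. *)
definition has_partials_on :: "('a::euclidean_space \<Rightarrow> real) \<Rightarrow> 'a set \<Rightarrow> bool" where
  "has_partials_on u S \<longleftrightarrow> (\<forall>b\<in>Basis. \<forall>x\<in>S. (\<lambda>t. u (x + t *\<^sub>R b)) differentiable at 0)"

(* Intended for open S only; the values of partial b u on S then depend only on u on S. *)
primrec C_k_on :: "nat \<Rightarrow> ('a::euclidean_space \<Rightarrow> real) \<Rightarrow> 'a set \<Rightarrow> bool" where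
  "C_k_on 0 u S \<longleftrightarrow> continuous_on S u"
| "C_k_on (Suc k) u S \<longleftrightarrow>
     continuous_on S u \<and> has_partials_on u S \<and> (\<forall>b\<in>Basis. C_k_on k (partial b u) S)"

definition laplacian :: "('a::euclidean_space \<Rightarrow> real) \<Rightarrow> 'a \<Rightarrow> real" where
  "laplacian u x = (\<Sum>b\<in>Basis. partial b (partial b u) x)"

definition Omega_inf :: "(real \<times> real) set" where
  "Omega_inf = UNIV \<times> {0<..<1}"

(* Classical solutions: C^2 inside, continuous up to the boundary.
   The values of u outside the closed strip are irrelevant. *)
definition dirichlet_solution :: "(real \<Rightarrow> real) \<Rightarrow> (real \<times> real \<Rightarrow> real) \<Rightarrow> bool" where
  "dirichlet_solution f u \<longleftrightarrow>
     C_k_on 2 u Omega_inf \<and> continuous_on (closure Omega_inf) u \<and>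
     (\<forall>x\<in>Omega_inf. - laplacian u x = f (u x)) \<and>
     (\<forall>x1. u (x1, 0) = 0 \<and> u (x1, 1) = 0)"

definition monotone_along_x1 :: "(real \<times> real \<Rightarrow> real) \<Rightarrow> bool" where
  "monotone_along_x1 u \<longleftrightarrow>
     (\<forall>x2\<in>{0<..<1}. mono (\<lambda>x1. u (x1, x2))) \<or>
     (\<forall>x2\<in>{0<..<1}. antimono (\<lambda>x1. u (x1, x2)))"

end

theory Submission
  imports Defs
begin

text \<open>
  For the constant nonlinearity \<open>f = 1\<close>, add the positive harmonic function
  \<open>exp (\<pi> x\<^sub>1) sin (\<pi> x\<^sub>2)\<close>, which vanishes on the boundary of the strip, to the one-dimensional
  torsion function \<open>x\<^sub>2 (1 - x\<^sub>2) / 2\<close>. The sum increases in \<open>x\<^sub>1\<close>. The superlevel set at the maximum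
  \<open>1/8\<close> of the torsion function contains the whole line \<open>x\<^sub>2 = 1/2\<close>, so if convex it would be
  invariant under translation in \<open>x\<^sub>1\<close>; but its sections at fixed \<open>x\<^sub>1\<close> grow from \<open>{1/2}\<close> to
  \<open>(0,1)\<close> as \<open>x\<^sub>1\<close> runs from \<open>-\<infinity>\<close> to \<open>\<infinity>\<close>.
\<close>

definition torsion_plus_harmonic :: "real \<times> real \<Rightarrow> real" where
  "torsion_plus_harmonic x =
     snd x * (1 - snd x) / 2 + exp (pi * fst x) * sin (pi * snd x)"

lemma Basis_real_prod: "(Basis :: (real \<times> real) set) = {(1, 0), (0, 1)}"
  by (auto simp: Basis_prod_def)

text \<open>Assuming the derivative at every \<open>x\<close> gives an equality of functions, which
  can be rewritten inside an outer \<open>partial\<close>.\<close>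

lemma deriv_imp_partial:
  assumes "\<And>x. ((\<lambda>t. u (x + t *\<^sub>R b)) has_real_derivative v x) (at 0)"
  shows "partial b u = v"
  unfolding partial_def by (rule ext, rule DERIV_imp_deriv, rule assms)

lemma torsion_plus_harmonic_deriv_fst:
  "((\<lambda>t. torsion_plus_harmonic (x + t *\<^sub>R (1, 0))) has_real_derivative
     pi * exp (pi * fst x) * sin (pi * snd x)) (at 0)"
  unfolding torsion_plus_harmonic_def
  by (auto intro!: derivative_eq_intros)

lemma torsion_plus_harmonic_deriv_snd:
  "((\<lambda>t. torsion_plus_harmonic (x + t *\<^sub>R (0, 1))) has_real_derivative
     (1 - 2 * snd x) / 2 + pi * exp (pi * fst x) * cos (pi * snd x)) (at 0)"
  unfolding torsion_plus_harmonic_def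
  by (auto intro!: derivative_eq_intros simp: field_simps)

lemmas partial_torsion_plus_harmonic =
  deriv_imp_partial[OF torsion_plus_harmonic_deriv_fst]
  deriv_imp_partial[OF torsion_plus_harmonic_deriv_snd]

text \<open>The mixed derivatives serve \<open>C_k_on 2\<close>. The pure ones sum to the Laplacian:
  their \<open>pi\<^sup>2\<close> terms cancel, and the torsion part leaves -1.\<close>

lemma torsion_plus_harmonic_deriv2:
  "((\<lambda>t. pi * exp (pi * fst (x + t *\<^sub>R (1, 0))) * sin (pi * snd (x + t *\<^sub>R (1, 0))))
     has_real_derivative pi\<^sup>2 * exp (pi * fst x) * sin (pi * snd x)) (at 0)"
  "((\<lambda>t. pi * exp (pi * fst (x + t *\<^sub>R (0, 1))) * sin (pi * snd (x + t *\<^sub>R (0, 1))))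
     has_real_derivative pi\<^sup>2 * exp (pi * fst x) * cos (pi * snd x)) (at 0)"
  "((\<lambda>t. (1 - 2 * snd (x + t *\<^sub>R (1, 0))) / 2
        + pi * exp (pi * fst (x + t *\<^sub>R (1, 0))) * cos (pi * snd (x + t *\<^sub>R (1, 0))))
     has_real_derivative pi\<^sup>2 * exp (pi * fst x) * cos (pi * snd x)) (at 0)"
  "((\<lambda>t. (1 - 2 * snd (x + t *\<^sub>R (0, 1))) / 2
        + pi * exp (pi * fst (x + t *\<^sub>R (0, 1))) * cos (pi * snd (x + t *\<^sub>R (0, 1))))
     has_real_derivative - 1 - pi\<^sup>2 * exp (pi * fst x) * sin (pi * snd x)) (at 0)"
  for x :: "real \<times> real"
  by (auto intro!: derivative_eq_intros simp: power2_eq_square)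

lemmas partial2_torsion_plus_harmonic = torsion_plus_harmonic_deriv2[THEN deriv_imp_partial]

lemma continuous_on_torsion_plus_harmonic: "continuous_on S torsion_plus_harmonic"
  unfolding torsion_plus_harmonic_def by (intro continuous_intros) auto

lemma C2_torsion_plus_harmonic: "C_k_on 2 torsion_plus_harmonic S"
  unfolding numeral_2_eq_2 C_k_on.simps Basis_real_prod has_partials_on_def
  by (simp only: ball_simps partial_torsion_plus_harmonic partial2_torsion_plus_harmonic)
    (intro conjI ballI TrueI continuous_on_torsion_plus_harmonic
      torsion_plus_harmonic_deriv_fst[THEN has_field_derivative_imp_has_derivative, THEN differentiableI]
      torsion_plus_harmonic_deriv_snd[THEN has_field_derivative_imp_has_derivative, THEN differentiableI]
      torsion_plus_harmonic_deriv2[THEN has_field_derivative_imp_has_derivative, THEN differentiableI];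
      intro continuous_intros; simp)

lemma laplacian_torsion_plus_harmonic: "laplacian torsion_plus_harmonic x = - 1"
  by (simp add: laplacian_def Basis_real_prod partial_torsion_plus_harmonic
      partial2_torsion_plus_harmonic)

lemma dirichlet_solution_torsion_plus_harmonic:
  "dirichlet_solution (\<lambda>_. 1) torsion_plus_harmonic"
  by (simp add: dirichlet_solution_def C2_torsion_plus_harmonic
      continuous_on_torsion_plus_harmonic laplacian_torsion_plus_harmonic)
    (simp add: torsion_plus_harmonic_def)

lemma sin_pi_mult_pos: "0 < y \<Longrightarrow> y < 1 \<Longrightarrow> 0 < sin (pi * y)"
  by (rule sin_gt_zero) auto

lemma torsion_plus_harmonic_pos: "x \<in> Omega_inf \<Longrightarrow> 0 < torsion_plus_harmonic x"
  by (auto simp: Omega_inf_def torsion_plus_harmonic_def intro!: add_pos_pos mult_pos_pos sin_pi_mult_pos)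

lemma monotone_torsion_plus_harmonic: "monotone_along_x1 torsion_plus_harmonic"
  unfolding monotone_along_x1_def torsion_plus_harmonic_def
  by (auto intro!: disjI1 monoI mult_right_mono less_imp_le[OF sin_pi_mult_pos])

text \<open>A single midpoint suffices: it joins an off-centre point at \<open>x1 = 0\<close> to a
  point far to the left on the centre line.\<close>

lemma not_convex_superlevel_torsion_plus_harmonic:
  "\<not> convex {x \<in> Omega_inf. torsion_plus_harmonic x > 1 / 8}" (is "\<not> convex ?S")
proof
  assume "convex ?S"
  \<comment> \<open>Chosen so that \<open>exp (- (pi * M))\<close> is 1/72 = 1/8 - 1/9, the gap
    between the torsion values at heights 1/2 and 1/3.\<close>
  define M where "M = ln 72 / pi"
  \<comment> \<open>The value here is 5/72 + 1/2.\<close>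
  have P: "(0, 1 / 6) \<in> ?S"
    by (simp add: Omega_inf_def torsion_plus_harmonic_def sin_30)
  \<comment> \<open>The torsion part is exactly 1/8 and the harmonic part is positive.\<close>
  have Q: "(- 2 * M, 1 / 2) \<in> ?S"
    by (simp add: Omega_inf_def torsion_plus_harmonic_def)
  have "(1 / 2) *\<^sub>R (0, 1 / 6) + (1 / 2) *\<^sub>R (- 2 * M, 1 / 2) \<in> ?S"
    using \<open>convex ?S\<close> P Q by (rule convexD) auto
  then have "(- M, 1 / 3) \<in> ?S"
    by simp
  then have "1 / 8 < 1 / 9 + exp (- (pi * M)) * sin (pi / 3)"
    by (simp add: torsion_plus_harmonic_def)
  moreover have "exp (- (pi * M)) = 1 / 72"
    by (simp add: M_def exp_minus)
  \<comment> \<open>Since the sine is at most 1, the midpoint value is at most 1/9 + 1/72 =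
    1/8.\<close>
  ultimately show False
    using sin_le_one[of "pi / 3"] by simp
qed

lemma smooth_const: "smooth (\<lambda>_. c)"
proof -
  \<comment> \<open>The constant \<open>d\<close> depends on \<open>n\<close>: it is
    \<open>c\<close> at first and 0 afterwards.\<close>
  have "\<exists>d. (deriv ^^ n) (\<lambda>_ :: real. c) = (\<lambda>_. d)" for n
    by (induction n) auto
  then show ?thesis
    unfolding smooth_def by (metis differentiable_const)
qed

theorem theorem1p3:
  shows "\<exists>(f :: real \<Rightarrow> real) (u :: real \<times> real \<Rightarrow> real).
    smooth f \<and>
    dirichlet_solution f u \<and>
    (\<forall>x\<in>Omega_inf. u x > 0) \<and>
    monotone_along_x1 u \<and>
    (\<exists>\<alpha>>0. \<not> convex {x \<in> Omega_inf. u x > \<alpha>})"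
  using smooth_const[of 1] dirichlet_solution_torsion_plus_harmonic torsion_plus_harmonic_pos
    monotone_torsion_plus_harmonic not_convex_superlevel_torsion_plus_harmonic
  by (intro exI[of _ "\<lambda>_. 1"] exI[of _ torsion_plus_harmonic] conjI exI[of _ "1 / 8"]) auto

end
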